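(* Let $0 < e_2 < e_1 < 1$. If a uninorm $U_1\equiv\langle T_1,e_1,S_1\rangle$ is distributive over a uninorm $U_2\equiv\langle T_2,e_2,S_2\rangle$, then $U_2 \equiv\langle \min, e_2, S_2\rangle$ (that is, $T_2=\min$) and $U_2$ is locally internal on $A(e_2)$.
   Context: A uninorm is a binary operation $U:[0,1]^2\to[0,1]$ that is commutative, associative, increasing (non-decreasing) in each variable with respect to the usual order, and has a neutral element $e\in[0,1]$. A uninorm is a t-norm if $e=1$ and a t-conorm if $e=0$. For $e\in\,]0,1[$, the notation $U\equiv\langle T,e,S\rangle$ means that $U$ is a uninorm with neutral element $e$, underlying t-norm $T$ and underlying t-conorm $S$, i.e. $T,S:[0,1]^2\to[0,1]$ are the t-norm and t-conorm with $U(x,y)=e\,T\left(\frac{x}{e},\frac{y}{e}\right)$ for $x,y\in[0,e]$ and $U(x,y)=e+(1-e)\,S\left(\frac{x-e}{1-e},\frac{y-e}{1-e}\right)$ for $x,y\in[e,1]$. $A(e)=[0,1]^2\setminus([0,e]^2\cup[e,1]^2)$. A uninorm $U$ with neutral element $e$ is locally internal on $A(e)$ if $U(x,y)\in\{x,y\}$ for all $(x,y)\in A(e)$. A uninorm $U_1$ is distributive over a uninorm $U_2$ if $U_1(x,U_2(y,z))=U_2(U_1(x,y),U_1(x,z))$ for all $x,y,z\in[0,1]$. *)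

theory Defs
  imports Complex_Main
begin

(* Binary operations on [0,1] are represented by total functions on the reals;
   only their values on the unit square are constrained or used. *)

definition neutral_element :: "(real \<Rightarrow> real \<Rightarrow> real) \<Rightarrow> real \<Rightarrow> bool" where
  "neutral_element U e \<longleftrightarrow> e \<in> {0..1} \<and> (\<forall>x\<in>{0..1}. U e x = x \<and> U x e = x)"

definition uninorm :: "(real \<Rightarrow> real \<Rightarrow> real) \<Rightarrow> bool" where
  "uninorm U \<longleftrightarrow>
     (\<forall>x\<in>{0..1}. \<forall>y\<in>{0..1}. U x y \<in> {0..1}) \<and>
     (\<forall>x\<in>{0..1}. \<forall>y\<in>{0..1}. U x y = U y x) \<and>
     (\<forall>x\<in>{0..1}. \<forall>y\<in>{0..1}. \<forall>z\<in>{0..1}. U (U x y) z = U x (U y z)) \<and>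
     (\<forall>y\<in>{0..1}. mono_on {0..1} (\<lambda>x. U x y)) \<and>
     (\<forall>x\<in>{0..1}. mono_on {0..1} (\<lambda>y. U x y)) \<and>
     (\<exists>e. neutral_element U e)"

definition t_norm :: "(real \<Rightarrow> real \<Rightarrow> real) \<Rightarrow> bool" where
  "t_norm T \<longleftrightarrow> uninorm T \<and> neutral_element T 1"

definition t_conorm :: "(real \<Rightarrow> real \<Rightarrow> real) \<Rightarrow> bool" where
  "t_conorm S \<longleftrightarrow> uninorm S \<and> neutral_element S 0"

(* The notation U \<equiv> \<langle>T, e, S\<rangle>.  Here T and S are determined by U and e
   on the unit square only. *)
definition uninorm_with :: "(real \<Rightarrow> real \<Rightarrow> real) \<Rightarrow> (real \<Rightarrow> real \<Rightarrow> real) \<Rightarrow> real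
    \<Rightarrow> (real \<Rightarrow> real \<Rightarrow> real) \<Rightarrow> bool" where
  "uninorm_with U T e S \<longleftrightarrow>
     0 < e \<and> e < 1 \<and> uninorm U \<and> neutral_element U e \<and> t_norm T \<and> t_conorm S \<and>
     (\<forall>x\<in>{0..e}. \<forall>y\<in>{0..e}. U x y = e * T (x / e) (y / e)) \<and>
     (\<forall>x\<in>{e..1}. \<forall>y\<in>{e..1}.
        U x y = e + (1 - e) * S ((x - e) / (1 - e)) ((y - e) / (1 - e)))"

definition A_region :: "real \<Rightarrow> (real \<times> real) set" where
  "A_region e = {0..1} \<times> {0..1} - ({0..e} \<times> {0..e} \<union> {e..1} \<times> {e..1})"

definition locally_internal_on :: "(real \<Rightarrow> real \<Rightarrow> real) \<Rightarrow> (real \<times> real) set \<Rightarrow> bool" where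
  "locally_internal_on U D \<longleftrightarrow> (\<forall>(x, y)\<in>D. U x y \<in> {x, y})"

definition distributive_over :: "(real \<Rightarrow> real \<Rightarrow> real) \<Rightarrow> (real \<Rightarrow> real \<Rightarrow> real) \<Rightarrow> bool" where
  "distributive_over U1 U2 \<longleftrightarrow>
     (\<forall>x\<in>{0..1}. \<forall>y\<in>{0..1}. \<forall>z\<in>{0..1}. U1 x (U2 y z) = U2 (U1 x y) (U1 x z))"

end

theory Submission
  imports Defs
begin

text \<open>
  Distributing \<open>U1 x\<close> over \<open>U2 e1 e1\<close> gives \<open>U1 x (U2 e1 e1) = U2 x x\<close>. Since \<open>e1\<close> lies above the
  neutral element of \<open>U2\<close>, the value \<open>U2 e1 e1\<close> is at least \<open>e1\<close>, and hence \<open>U2 x x \<ge> x\<close> for every \<open>x\<close>.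
  Below \<open>e2\<close> the opposite inequality always holds, so \<open>U2\<close> is idempotent there and its underlying
  t-norm is \<open>min\<close> (lemma \<open>distributive_imp_idempotent_below\<close>).

  For local internality let \<open>x < e2 < y\<close> and \<open>w = U2 x y\<close>, so that \<open>x \<le> w \<le> y\<close>. Idempotence of \<open>x\<close>
  yields \<open>U2 x w = w\<close>, so \<open>w \<le> e2\<close> forces \<open>w = x\<close>, and the case to be understood is \<open>w > e2\<close>.
  For \<open>y = e1\<close> it is impossible: \<open>U1 e2\<close> would map \<open>w\<close> to a value at least \<open>e2\<close>, whereas
  distributivity maps it to \<open>U1 e2 x \<le> x\<close> (lemma \<open>distributive_absorbs_up_to_neutral\<close>). By
  monotonicity \<open>U2 x y = x\<close> whenever \<open>e2 \<le> y \<le> e1\<close>. For \<open>y \<ge> e1\<close>, distributing \<open>U1 y\<close> over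
  \<open>U2 x e1 = x\<close> shows that \<open>w > e2\<close> makes \<open>y\<close> an idempotent element of \<open>U2\<close>, and then
  \<open>w = U2 x (U2 y y) = U2 w y \<ge> y\<close> (lemma \<open>distributive_internal_above_neutral\<close>).
\<close>

section \<open>Order properties of uninorms\<close>

lemma uninorm_closed:
  assumes "uninorm U" "x \<in> {0..1}" "y \<in> {0..1}"
  shows "U x y \<in> {0..1}"
  using assms unfolding uninorm_def by blast

lemma uninorm_commute:
  assumes "uninorm U" "x \<in> {0..1}" "y \<in> {0..1}"
  shows "U x y = U y x"
  using assms unfolding uninorm_def by blast

lemma uninorm_assoc:
  assumes "uninorm U" "x \<in> {0..1}" "y \<in> {0..1}" "z \<in> {0..1}"
  shows "U (U x y) z = U x (U y z)"
  using assms unfolding uninorm_def by blast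

lemma uninorm_mono:
  assumes U: "uninorm U" and "x \<in> {0..1}" "x' \<in> {0..1}" "y \<in> {0..1}" "y' \<in> {0..1}"
    and "x \<le> x'" "y \<le> y'"
  shows "U x y \<le> U x' y'"
proof -
  have "mono_on {0..1} (\<lambda>x. U x y)" "mono_on {0..1} (\<lambda>y. U x' y)"
    using assms unfolding uninorm_def by blast+
  then have "U x y \<le> U x' y" "U x' y \<le> U x' y'"
    using assms(2-) by (auto intro: mono_onD[where f = "\<lambda>x. U x y"] mono_onD[where f = "U x'"])
  then show ?thesis by simp
qed

lemma neutral_elementD:
  assumes "neutral_element U e"
  shows "e \<in> {0..1}" and "\<And>x. x \<in> {0..1} \<Longrightarrow> U e x = x" and "\<And>x. x \<in> {0..1} \<Longrightarrow> U x e = x"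
  using assms unfolding neutral_element_def by auto

lemma uninorm_decreases_below_neutral:
  assumes "uninorm U" "neutral_element U e" "x \<in> {0..1}" "y \<in> {0..1}" "x \<le> e"
  shows "U x y \<le> y" "U y x \<le> y"
  using uninorm_mono[OF assms(1), of x e y y] uninorm_mono[OF assms(1), of y y x e]
    neutral_elementD[OF assms(2)] assms by auto

lemma uninorm_increases_above_neutral:
  assumes "uninorm U" "neutral_element U e" "x \<in> {0..1}" "y \<in> {0..1}" "e \<le> x"
  shows "y \<le> U x y" "y \<le> U y x"
  using uninorm_mono[OF assms(1), of e x y y] uninorm_mono[OF assms(1), of y y e x]
    neutral_elementD[OF assms(2)] assms by auto

lemma uninorm_min_if_idempotent_below:
  assumes U: "uninorm U" and e: "neutral_element U e"
    and idem: "\<And>x. 0 \<le> x \<Longrightarrow> x \<le> e \<Longrightarrow> U x x = x"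
    and xy: "x \<in> {0..e}" "y \<in> {0..e}"
  shows "U x y = min x y"
proof -
  let ?m = "min x y"
  have unit: "x \<in> {0..1}" "y \<in> {0..1}" "?m \<in> {0..1}"
    using xy neutral_elementD(1)[OF e] by auto
  have "U x y \<le> ?m"
    using uninorm_decreases_below_neutral[OF U e] unit xy by simp
  moreover have "?m = U ?m ?m" using idem xy by (simp add: min_def)
  moreover have "U ?m ?m \<le> U x y" using uninorm_mono[OF U] unit by simp
  ultimately show ?thesis by linarith
qed

text \<open>
  An idempotent \<open>x\<close> acts trivially on \<open>U x y\<close>. A value of at most \<open>e\<close> would decrease \<open>x\<close>, while
  \<open>y \<ge> e\<close> increases it.
\<close>

lemma uninorm_eq_left_if_le_neutral:
  assumes U: "uninorm U" and e: "neutral_element U e"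
    and xy: "x \<in> {0..1}" "y \<in> {0..1}" and "e \<le> y"
    and idem: "U x x = x" and le: "U x y \<le> e"
  shows "U x y = x"
proof (rule antisym)
  have "U x y = U x (U x y)" using uninorm_assoc[OF U xy(1) xy] idem by simp
  also have "\<dots> \<le> x"
    using uninorm_decreases_below_neutral(2)[OF U e] uninorm_closed[OF U xy] xy(1) le by blast
  finally show "U x y \<le> x" .
  show "x \<le> U x y"
    using uninorm_increases_above_neutral(2)[OF U e] xy \<open>e \<le> y\<close> by blast
qed

section \<open>Distributivity over a uninorm with a smaller neutral element\<close>

lemma distributive_overD:
  assumes "distributive_over U V" "x \<in> {0..1}" "y \<in> {0..1}" "z \<in> {0..1}"
  shows "U x (V y z) = V (U x y) (U x z)"
  using assms unfolding distributive_over_def by blast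

text \<open>The point \<open>V d d\<close> lies above \<open>d\<close>, so \<open>V x x = U x (V d d)\<close> lies above \<open>x\<close>.\<close>

lemma distributive_imp_idempotent_below:
  assumes U: "uninorm U" and d: "neutral_element U d"
    and V: "uninorm V" and e: "neutral_element V e" and "e \<le> d"
    and dist: "distributive_over U V"
    and x: "0 \<le> x" "x \<le> e"
  shows "V x x = x"
proof (rule antisym)
  have d1: "d \<in> {0..1}" using neutral_elementD(1)[OF d] .
  have x1: "x \<in> {0..1}" using x neutral_elementD(1)[OF e] by simp
  show "V x x \<le> x" using uninorm_decreases_below_neutral[OF V e x1 x1 x(2)] by simp
  have "d \<le> V d d" using uninorm_increases_above_neutral[OF V e d1 d1 \<open>e \<le> d\<close>] by simp
  then have "x \<le> U x (V d d)"
    using uninorm_increases_above_neutral(2)[OF U d _ x1] uninorm_closed[OF V d1 d1] by blast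
  also have "\<dots> = V x x"
    using distributive_overD[OF dist x1 d1 d1] neutral_elementD(3)[OF d x1] by simp
  finally show "x \<le> V x x" .
qed

text \<open>
  Otherwise \<open>w = V x d\<close> exceeds \<open>e\<close>. Then \<open>V w w \<ge> d\<close>, because \<open>V w w = V w d\<close>. Applying \<open>U e\<close> to
  \<open>V w w\<close> and to \<open>w\<close> yields \<open>e \<le> U e w\<close> and \<open>U e w = U e x \<le> x\<close>, respectively.
\<close>

lemma distributive_absorbs_up_to_neutral:
  assumes U: "uninorm U" and d: "neutral_element U d"
    and V: "uninorm V" and e: "neutral_element V e" and "e \<le> d"
    and dist: "distributive_over U V"
    and x: "0 \<le> x" "x < e"
  shows "V x d = x"
proof (rule ccontr)
  assume "V x d \<noteq> x"
  define w where "w = V x d"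
  have d1: "d \<in> {0..1}" using neutral_elementD(1)[OF d] .
  have e1: "e \<in> {0..1}" using neutral_elementD(1)[OF e] .
  have x1: "x \<in> {0..1}" using x e1 by simp
  have w1: "w \<in> {0..1}" unfolding w_def by (rule uninorm_closed[OF V x1 d1])
  have idem: "V z z = z" if "0 \<le> z" "z \<le> e" for z
    using distributive_imp_idempotent_below[OF U d V e \<open>e \<le> d\<close> dist that] .
  have "e < w"
    using uninorm_eq_left_if_le_neutral[OF V e x1 d1 \<open>e \<le> d\<close>] idem x \<open>V x d \<noteq> x\<close>
    unfolding w_def by force
  have "w \<le> d"
    using uninorm_decreases_below_neutral(1)[OF V e x1 d1] x unfolding w_def by simp
  have "V x w = w"
    using uninorm_assoc[OF V x1 x1 d1] idem x unfolding w_def by simp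
  then have "V w w = V w d"
    using uninorm_assoc[OF V d1 x1 w1] uninorm_commute[OF V] x1 d1 w1 unfolding w_def by metis
  then have "d \<le> V w w"
    using uninorm_increases_above_neutral(1)[OF V e w1 d1] \<open>e < w\<close> by simp
  then have "e \<le> U e (V w w)"
    using uninorm_increases_above_neutral(2)[OF U d _ e1] uninorm_closed[OF V w1 w1] by blast
  also have "\<dots> = V (U e w) (U e w)" by (rule distributive_overD[OF dist e1 w1 w1])
  also have "\<dots> = U e w"
    using idem uninorm_closed[OF U e1 w1] uninorm_decreases_below_neutral(2)[OF U d w1 e1 \<open>w \<le> d\<close>]
    by simp
  also have "\<dots> = V (U e x) (U e d)"
    unfolding w_def by (rule distributive_overD[OF dist e1 x1 d1])
  also have "\<dots> = U e x"
    using neutral_elementD(3)[OF d e1] neutral_elementD(3)[OF e] uninorm_closed[OF U e1 x1] by simp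
  also have "\<dots> \<le> x" using uninorm_decreases_below_neutral(1)[OF U d e1 x1 \<open>e \<le> d\<close>] .
  finally show False using x by simp
qed

text \<open>
  The key element is \<open>p = U y x\<close>. Since \<open>V x d = x\<close>, distributivity yields \<open>p = V p y\<close>. If \<open>p \<le> e\<close>,
  then \<open>V x y \<le> V p y = p\<close> is at most \<open>e\<close>, so it equals \<open>x\<close>. If \<open>p > e\<close>, then \<open>p\<close> lies both above
  and below \<open>y\<close>, so \<open>p = y\<close> and \<open>y\<close> is an idempotent of \<open>V\<close>. Now
  \<open>V x y = V (V x y) y\<close>, which is at least \<open>y\<close> when \<open>V x y > e\<close>.
\<close>

lemma distributive_internal_above_neutral:
  assumes U: "uninorm U" and d: "neutral_element U d"
    and V: "uninorm V" and e: "neutral_element V e" and "e \<le> d"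
    and dist: "distributive_over U V"
    and x: "0 \<le> x" "x < e" and y: "d \<le> y" "y \<le> 1"
  shows "V x y \<in> {x, y}"
proof -
  have x1: "x \<in> {0..1}" and y1: "y \<in> {0..1}"
    using x y neutral_elementD(1)[OF d] neutral_elementD(1)[OF e] by auto
  show ?thesis
  proof (cases "V x y \<le> e")
    case True
    then show ?thesis
      using uninorm_eq_left_if_le_neutral[OF V e x1 y1]
        distributive_imp_idempotent_below[OF U d V e \<open>e \<le> d\<close> dist] x y \<open>e \<le> d\<close> by simp
  next
    case False
    define p where "p = U y x"
    have d1: "d \<in> {0..1}" using neutral_elementD(1)[OF d] .
    have p1: "p \<in> {0..1}" unfolding p_def by (rule uninorm_closed[OF U y1 x1])
    have "p = U y (V x d)"
      using distributive_absorbs_up_to_neutral[OF U d V e \<open>e \<le> d\<close> dist x] p_def by simp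
    also have "\<dots> = V p y"
      using distributive_overD[OF dist y1 x1 d1] neutral_elementD(3)[OF d y1] p_def by simp
    finally have p_fix: "p = V p y" .
    have "x \<le> p"
      unfolding p_def using uninorm_increases_above_neutral(1)[OF U d y1 x1 y(1)] .
    then have "V x y \<le> p" using uninorm_mono[OF V x1 p1 y1 y1] p_fix by simp
    then have "e < p" using False by simp
    then have "y \<le> p" using uninorm_increases_above_neutral(1)[OF V e p1 y1] p_fix by simp
    moreover have "p \<le> y"
      unfolding p_def using uninorm_decreases_below_neutral(2)[OF U d x1 y1] x \<open>e \<le> d\<close> by simp
    ultimately have idem: "V y y = y" using p_fix by simp
    have w1: "V x y \<in> {0..1}" by (rule uninorm_closed[OF V x1 y1])
    have "y \<le> V (V x y) y"
      using uninorm_increases_above_neutral(1)[OF V e w1 y1] False by simp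
    also have "\<dots> = V x y" using uninorm_assoc[OF V x1 y1 y1] idem by simp
    finally have "y \<le> V x y" .
    moreover have "V x y \<le> y"
      using uninorm_decreases_below_neutral(1)[OF V e x1 y1] x by simp
    ultimately show ?thesis by simp
  qed
qed

lemma distributive_imp_locally_internal:
  assumes U: "uninorm U" and d: "neutral_element U d"
    and V: "uninorm V" and e: "neutral_element V e" and "e \<le> d"
    and dist: "distributive_over U V"
  shows "locally_internal_on V (A_region e)"
proof -
  have d1: "d \<in> {0..1}" and e1: "e \<in> {0..1}"
    using neutral_elementD(1) d e by blast+
  have across: "V x y \<in> {x, y}" if x: "0 \<le> x" "x < e" and y: "e \<le> y" "y \<le> 1" for x y
  proof (cases "d \<le> y")
    case True
    then show ?thesis
      using distributive_internal_above_neutral[OF U d V e \<open>e \<le> d\<close> dist] x y by blast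
  next
    case False
    have x1: "x \<in> {0..1}" and y1: "y \<in> {0..1}" using x y e1 by auto
    have "V x y \<le> V x d" using uninorm_mono[OF V x1 x1 y1 d1] False by simp
    also have "\<dots> = x"
      by (rule distributive_absorbs_up_to_neutral[OF U d V e \<open>e \<le> d\<close> dist x])
    finally show ?thesis
      using uninorm_increases_above_neutral(2)[OF V e y1 x1] y by simp
  qed
  have "V x y \<in> {x, y}" if A: "(x, y) \<in> A_region e" for x y
  proof -
    have xy: "x \<in> {0..1}" "y \<in> {0..1}" using A unfolding A_region_def by auto
    consider "x < e" "e \<le> y" | "y < e" "e \<le> x" using A unfolding A_region_def by force
    then show ?thesis
    proof cases
      case 1
      then show ?thesis using across xy by simp
    next
      case 2
      then have "V y x \<in> {y, x}" using across xy by simp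
      then show ?thesis using uninorm_commute[OF V xy] by auto
    qed
  qed
  then show ?thesis unfolding locally_internal_on_def by blast
qed

section \<open>The underlying t-norm\<close>

lemma t_norm_min: "t_norm min"
proof -
  have "neutral_element min (1::real)" unfolding neutral_element_def by auto
  moreover from this have "uninorm min"
    unfolding uninorm_def by (auto simp: mono_on_def min_def)
  ultimately show ?thesis unfolding t_norm_def by simp
qed

theorem corollary1:
  fixes U1 U2 T1 T2 S1 S2 :: "real \<Rightarrow> real \<Rightarrow> real" and e1 e2 :: real
  assumes "0 < e2" and "e2 < e1" and "e1 < 1"
    and "uninorm_with U1 T1 e1 S1"
    and "uninorm_with U2 T2 e2 S2"
    and "distributive_over U1 U2"
  shows "uninorm_with U2 min e2 S2
    \<and> (\<forall>x\<in>{0..1}. \<forall>y\<in>{0..1}. T2 x y = min x y)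
    \<and> locally_internal_on U2 (A_region e2)"
proof -
  have U: "uninorm U1" "neutral_element U1 e1" and V: "uninorm U2" "neutral_element U2 e2"
    using assms(4,5) unfolding uninorm_with_def by auto
  have "e2 \<le> e1" using assms(2) by simp
  have U2_min: "U2 x y = min x y" if "x \<in> {0..e2}" "y \<in> {0..e2}" for x y
    by (rule uninorm_min_if_idempotent_below[OF V _ that])
      (rule distributive_imp_idempotent_below[OF U V \<open>e2 \<le> e1\<close> assms(6)])
  have scale: "e2 * min x y = min (e2 * x) (e2 * y)" for x y :: real
    using \<open>0 < e2\<close> by (simp add: min_mult_distrib_left)
  have "uninorm_with U2 min e2 S2"
    using assms(5) t_norm_min U2_min \<open>0 < e2\<close> unfolding uninorm_with_def scale by simp
  moreover have "T2 x y = min x y" if "x \<in> {0..1}" "y \<in> {0..1}" for x y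
  proof -
    have sq: "e2 * x \<in> {0..e2}" "e2 * y \<in> {0..e2}"
      using that \<open>0 < e2\<close> by (auto simp: mult_left_le)
    then have "U2 (e2 * x) (e2 * y) = e2 * T2 ((e2 * x) / e2) ((e2 * y) / e2)"
      using assms(5) unfolding uninorm_with_def by blast
    then have "e2 * T2 x y = U2 (e2 * x) (e2 * y)" using \<open>0 < e2\<close> by simp
    also have "\<dots> = e2 * min x y" using U2_min[OF sq] scale by simp
    finally show ?thesis using \<open>0 < e2\<close> by simp
  qed
  moreover have "locally_internal_on U2 (A_region e2)"
    by (rule distributive_imp_locally_internal[OF U V \<open>e2 \<le> e1\<close> assms(6)])
  ultimately show ?thesis by blast
qed

end
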